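(* Let $(R,f,g)$ be a commutative Krasner $(m,n)$-hyperring with scalar identity $1$, let $S$ be an $n$-ary multiplicative subset of $R$, and let $I$ be a normal hyperideal of $R$. If $J$ is an $n$-ary $S$-prime hyperideal of $R$ such that $I\subseteq J$, then $[J:I^*]$ is an $n$-ary $[S:I^*]$-prime hyperideal of $[R:I^*]$.
   Context: Notation: $x_i^j$ denotes the sequence $x_i,\dots,x_j$ (empty if $j<i$); $x^{(k)}$ denotes $x$ repeated $k$ times; operations are extended to subsets elementwise (taking unions); $m,n\ge 2$ are integers. An $m$-ary hyperoperation on $R$ is a map $f$ from $R^m$ to the nonempty subsets of $R$. $(R,f)$ is a (commutative) canonical $m$-ary hypergroup if $f$ is invariant under permuting its arguments; $f$ is associative, i.e. $f(x_1^{i-1},f(x_i^{m+i-1}),x_{m+i}^{2m-1})$ does not depend on $i$; for all $a_1^{i-1},a_{i+1}^m,b\in R$ there is $x\in R$ with $b\in f(a_1^{i-1},x,a_{i+1}^m)$; there is a unique $0\in R$ with $f(x,0^{(m-1)})=\{x\}$ for all $x$; each $x$ has a unique $-x$ with $0\in f(x,-x,0^{(m-2)})$; and $x\in f(x_1^m)$ implies $x_i\in f(x,-x_1,\dots,-x_{i-1},-x_{i+1},\dots,-x_m)$ for all $i$. A commutative Krasner $(m,n)$-hyperring $(R,f,g)$ is such an $(R,f)$ together with an associative, permutation-invariant $n$-ary operation $g:R^n\to R$ that is distributive over $f$ in each argument, i.e. $g(a_1^{i-1},f(x_1^m),a_{i+1}^n)=f(g(a_1^{i-1},x_1,a_{i+1}^n),\dots,g(a_1^{i-1},x_m,a_{i+1}^n))$,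 and satisfies $g(0,x_2^n)=0$. A scalar identity is an element $1$ with $g(x,1^{(n-1)})=x$ for all $x$. A hyperideal of $R$ is a nonempty $I\subseteq R$ such that $(I,f)$ is an $m$-ary subhypergroup of $(R,f)$ (i.e. $f(x_1^m)\subseteq I$ for $x_1^m\in I$, and $b\in f(b_1^{i-1},x,b_{i+1}^m)$ has a solution $x\in I$ whenever all $b$'s lie in $I$) and $g(x_1^{i-1},I,x_{i+1}^n)\subseteq I$ for all $x_j\in R$ and all $i$. An $n$-ary multiplicative subset is a nonempty $S\subseteq R$ with $g(s_1^n)\in S$ for all $s_1^n\in S$. A hyperideal $I$ with $I\cap S=\varnothing$ is an $n$-ary $S$-prime hyperideal if there exists $s\in S$ such that for all $x_1^n\in R$ with $g(x_1^n)\in I$ one has $g(s,x_i,1^{(n-2)})\in I$ for some $1\le i\le n$. A hyperideal $I$ is normal if $f(f(r,I,0^{(m-2)}),-r,0^{(m-2)})\subseteq I$ for every $r\in R$. For a normal hyperideal $I$, put $I^*[x]=f(I,x,0^{(m-2)})$; these sets are the equivalence classes of the relation $x\,I^*\,y \iff f(x,-y,0^{(m-2)})\cap I\neq\varnothing$. The set $[R:I^*]=\{I^*[x]\mid x\in R\}$ is a Krasner $(m,n)$-hyperring with $f/I(I^*[x_1],\dots,I^*[x_m])=\{I^*[z]\mid z\in f(I^*[x_1],\dots,I^*[x_m])\}$ and $g/I(I^*[x_1],\dots,I^*[x_n])=I^*[g(x_1^n)]$, with scalar identity $I^*[1]$. For a subset $A\subseteq R$, $[A:I^*]=\{I^*[x]\mid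 x\in A\}$. *)

theory Defs
  imports Main "HOL-Library.Multiset"
begin

text \<open>
  A finite argument sequence is a list, so an operation of arity \<open>k\<close> is a function on lists of
  which only the values on lists of length \<open>k\<close> over the carrier matter.
\<close>

record 'a hyperring =
  carrier :: "'a set"
  addop :: "'a list \<Rightarrow> 'a set"
  mulop :: "'a list \<Rightarrow> 'a"

definition args :: "nat \<Rightarrow> 'a set \<Rightarrow> 'a list set" where
  "args k A = {xs. length xs = k \<and> set xs \<subseteq> A}"

definition on_sets :: "('a list \<Rightarrow> 'a set) \<Rightarrow> 'a set list \<Rightarrow> 'a set" where
  "on_sets f Xs = (\<Union>xs\<in>listset Xs. f xs)"

definition is_zero :: "nat \<Rightarrow> 'a set \<Rightarrow> ('a list \<Rightarrow> 'a set) \<Rightarrow> 'a \<Rightarrow> bool" where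
  "is_zero m H f z \<longleftrightarrow> z \<in> H \<and> (\<forall>x\<in>H. f (x # replicate (m - 1) z) = {x})"

definition zero_of :: "nat \<Rightarrow> 'a set \<Rightarrow> ('a list \<Rightarrow> 'a set) \<Rightarrow> 'a" where
  "zero_of m H f = (THE z. is_zero m H f z)"

definition is_neg :: "nat \<Rightarrow> 'a set \<Rightarrow> ('a list \<Rightarrow> 'a set) \<Rightarrow> 'a \<Rightarrow> 'a \<Rightarrow> bool" where
  "is_neg m H f x y \<longleftrightarrow>
     y \<in> H \<and> zero_of m H f \<in> f (x # y # replicate (m - 2) (zero_of m H f))"

definition neg_of :: "nat \<Rightarrow> 'a set \<Rightarrow> ('a list \<Rightarrow> 'a set) \<Rightarrow> 'a \<Rightarrow> 'a" where
  "neg_of m H f x = (THE y. is_neg m H f x y)"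

definition canonical_hypergroup :: "nat \<Rightarrow> 'a set \<Rightarrow> ('a list \<Rightarrow> 'a set) \<Rightarrow> bool" where
  "canonical_hypergroup m H f \<longleftrightarrow>
     (\<forall>xs\<in>args m H. f xs \<noteq> {} \<and> f xs \<subseteq> H) \<and>
     (\<forall>xs\<in>args m H. \<forall>ys. mset xs = mset ys \<longrightarrow> f xs = f ys) \<and>
     \<comment> \<open>associativity: the value does not depend on the position of the inner block\<close>
     (\<forall>as xs bs cs ys ds.
        as @ xs @ bs \<in> args (2 * m - 1) H \<and> as @ xs @ bs = cs @ ys @ ds \<and>
        length xs = m \<and> length ys = m \<longrightarrow>
        (\<Union>z\<in>f xs. f (as @ z # bs)) = (\<Union>z\<in>f ys. f (cs @ z # ds))) \<and>
     (\<forall>as bs. as @ bs \<in> args (m - 1) H \<longrightarrow> (\<forall>b\<in>H. \<exists>x\<in>H. b \<in> f (as @ x # bs))) \<and>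
     (\<exists>!z. is_zero m H f z) \<and>
     (\<forall>x\<in>H. \<exists>!y. is_neg m H f x y) \<and>
     (\<forall>as y bs. as @ y # bs \<in> args m H \<longrightarrow>
        (\<forall>x\<in>f (as @ y # bs). y \<in> f (x # map (neg_of m H f) (as @ bs))))"

definition krasner_hyperring :: "nat \<Rightarrow> nat \<Rightarrow> 'a hyperring \<Rightarrow> bool" where
  "krasner_hyperring m n R \<longleftrightarrow>
     canonical_hypergroup m (carrier R) (addop R) \<and>
     (\<forall>xs\<in>args n (carrier R). mulop R xs \<in> carrier R) \<and>
     (\<forall>xs\<in>args n (carrier R). \<forall>ys. mset xs = mset ys \<longrightarrow> mulop R xs = mulop R ys) \<and>
     (\<forall>as xs bs cs ys ds.
        as @ xs @ bs \<in> args (2 * n - 1) (carrier R) \<and> as @ xs @ bs = cs @ ys @ ds \<and>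
        length xs = n \<and> length ys = n \<longrightarrow>
        mulop R (as @ mulop R xs # bs) = mulop R (cs @ mulop R ys # ds)) \<and>
     (\<forall>as bs. as @ bs \<in> args (n - 1) (carrier R) \<longrightarrow>
        (\<forall>xs\<in>args m (carrier R).
           (\<lambda>z. mulop R (as @ z # bs)) ` addop R xs =
           addop R (map (\<lambda>x. mulop R (as @ x # bs)) xs))) \<and>
     (\<forall>xs\<in>args (n - 1) (carrier R).
        mulop R (zero_of m (carrier R) (addop R) # xs) = zero_of m (carrier R) (addop R))"

definition scalar_identity :: "nat \<Rightarrow> 'a hyperring \<Rightarrow> 'a \<Rightarrow> bool" where
  "scalar_identity n R e \<longleftrightarrow>
     e \<in> carrier R \<and> (\<forall>x\<in>carrier R. mulop R (x # replicate (n - 1) e) = x)"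

definition subhypergroup :: "nat \<Rightarrow> 'a set \<Rightarrow> ('a list \<Rightarrow> 'a set) \<Rightarrow> 'a set \<Rightarrow> bool" where
  "subhypergroup m H f K \<longleftrightarrow>
     K \<subseteq> H \<and> K \<noteq> {} \<and>
     (\<forall>xs\<in>args m K. f xs \<subseteq> K) \<and>
     (\<forall>as bs. as @ bs \<in> args (m - 1) K \<longrightarrow> (\<forall>b\<in>K. \<exists>x\<in>K. b \<in> f (as @ x # bs)))"

definition hyperideal :: "nat \<Rightarrow> nat \<Rightarrow> 'a hyperring \<Rightarrow> 'a set \<Rightarrow> bool" where
  "hyperideal m n R I \<longleftrightarrow>
     subhypergroup m (carrier R) (addop R) I \<and>
     (\<forall>as bs. as @ bs \<in> args (n - 1) (carrier R) \<longrightarrow> (\<forall>x\<in>I. mulop R (as @ x # bs) \<in> I))"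

definition multiplicative_subset :: "nat \<Rightarrow> 'a hyperring \<Rightarrow> 'a set \<Rightarrow> bool" where
  "multiplicative_subset n R S \<longleftrightarrow>
     S \<subseteq> carrier R \<and> S \<noteq> {} \<and> (\<forall>xs\<in>args n S. mulop R xs \<in> S)"

text \<open>
  For \<open>n > 2\<close> a scalar identity need not be unique (for instance \<open>-1\<close> is one for the ternary
  product on the integers), hence the identity \<open>e\<close> is a parameter.
\<close>

definition S_prime_hyperideal ::
    "nat \<Rightarrow> nat \<Rightarrow> 'a hyperring \<Rightarrow> 'a \<Rightarrow> 'a set \<Rightarrow> 'a set \<Rightarrow> bool" where
  "S_prime_hyperideal m n R e S I \<longleftrightarrow>
     multiplicative_subset n R S \<and> hyperideal m n R I \<and> I \<inter> S = {} \<and>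
     (\<exists>s\<in>S. \<forall>xs\<in>args n (carrier R). mulop R xs \<in> I \<longrightarrow>
        (\<exists>i<n. mulop R (s # xs ! i # replicate (n - 2) e) \<in> I))"

definition normal_hyperideal :: "nat \<Rightarrow> nat \<Rightarrow> 'a hyperring \<Rightarrow> 'a set \<Rightarrow> bool" where
  "normal_hyperideal m n R I \<longleftrightarrow>
     hyperideal m n R I \<and>
     (let z = zero_of m (carrier R) (addop R) in
        \<forall>r\<in>carrier R.
          on_sets (addop R)
            (on_sets (addop R) ({r} # I # replicate (m - 2) {z})
              # {neg_of m (carrier R) (addop R) r} # replicate (m - 2) {z}) \<subseteq> I)"

definition ideal_class :: "nat \<Rightarrow> 'a hyperring \<Rightarrow> 'a set \<Rightarrow> 'a \<Rightarrow> 'a set" where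
  "ideal_class m R I x =
     on_sets (addop R) (I # {x} # replicate (m - 2) {zero_of m (carrier R) (addop R)})"

definition classes :: "nat \<Rightarrow> 'a hyperring \<Rightarrow> 'a set \<Rightarrow> 'a set \<Rightarrow> 'a set set" where
  "classes m R I A = {ideal_class m R I x | x. x \<in> A}"

text \<open>
  The product of classes is computed on representatives; the description operator is proper
  whenever \<open>I\<close> is a hyperideal of a Krasner hyperring, as the class of the product then
  does not depend on the representatives.
\<close>

definition quotient_hyperring :: "nat \<Rightarrow> nat \<Rightarrow> 'a hyperring \<Rightarrow> 'a set \<Rightarrow> 'a set hyperring" where
  "quotient_hyperring m n R I =
     \<lparr>carrier = classes m R I (carrier R),
      addop = (\<lambda>Xs. {ideal_class m R I z | z. z \<in> on_sets (addop R) Xs}),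
      mulop = (\<lambda>Xs. THE Y. \<exists>xs\<in>args n (carrier R).
                 Xs = map (ideal_class m R I) xs \<and> Y = ideal_class m R I (mulop R xs))\<rparr>"

end

theory Submission imports Defs begin

text \<open>
  Membership of \<open>y\<close> in the class of \<open>x\<close> is an equivalence relation because hyperideals contain
  zero and negatives, and by distributivity it is compatible with the product in each argument.
  Hence products in the quotient are computed on representatives. Since \<open>I \<subseteq> J\<close>, the hyperideal
  \<open>J\<close> is a union of classes, so membership of a class in the quotient of \<open>J\<close> can be tested on any
  representative; every required property then descends from \<open>R\<close>, the class of the
  element \<open>s\<close> that witnesses primeness of \<open>J\<close> being a witness in the quotient.
\<close>

section \<open>Lists of sets and lists of representatives\<close>

lemma in_listset_iff: "xs \<in> listset Xs \<longleftrightarrow> list_all2 (\<in>) xs Xs"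
  by (induction Xs arbitrary: xs) (auto simp: set_Cons_def list_all2_Cons2)

lemma listset_singletons: "listset (map (\<lambda>x. {x}) xs) = {xs}"
  by (induction xs) (auto simp: set_Cons_def)

text \<open>Representatives of all entries are chosen at once, so that statements about tuples of
  classes can be reduced to computations in \<open>R\<close>.\<close>

lemma args_classesE:
  assumes "Xs \<in> args k (classes m R I A)"
  obtains xs where "xs \<in> args k A" "Xs = map (ideal_class m R I) xs"
proof -
  have "set Xs \<subseteq> ideal_class m R I ` A"
    using assms by (auto simp: args_def classes_def)
  then obtain xs where "xs \<in> lists A" "Xs = map (ideal_class m R I) xs"
    by (metis imageE in_lists_conv_set lists_image subset_code(1))
  then show ?thesis
    using assms that by (auto simp: args_def)
qed

locale krasner_hyperideal =
  fixes m n :: nat and R :: "'a hyperring" and I :: "'a set"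
  assumes m_ge_2: "m \<ge> 2" and n_ge_2: "n \<ge> 2"
    and krasner: "krasner_hyperring m n R"
    and hyperideal: "hyperideal m n R I"
begin

abbreviation "H \<equiv> carrier R"
abbreviation "f \<equiv> addop R"
abbreviation "g \<equiv> mulop R"
abbreviation "z0 \<equiv> zero_of m H f"
abbreviation "neg \<equiv> neg_of m H f"
abbreviation "cls \<equiv> ideal_class m R I"
abbreviation "Q \<equiv> quotient_hyperring m n R I"

section \<open>The axioms as separate rules, with zero and negatives\<close>

lemma hypergroup: "canonical_hypergroup m H f"
  using krasner by (simp add: krasner_hyperring_def)

lemma zero: "is_zero m H f z0"
  using theI'[OF hypergroup[unfolded canonical_hypergroup_def,
      THEN conjunct2, THEN conjunct2, THEN conjunct2, THEN conjunct2, THEN conjunct1]]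
  by (simp add: zero_of_def)

lemma zero_in_carrier: "z0 \<in> H"
  using zero by (simp add: is_zero_def)

lemma neg_eqI:
  assumes "x \<in> H" "is_neg m H f x y"
  shows "neg x = y"
  using hypergroup[unfolded canonical_hypergroup_def,
      THEN conjunct2, THEN conjunct2, THEN conjunct2, THEN conjunct2,
      THEN conjunct2, THEN conjunct1] assms
  by (auto simp: neg_of_def intro: the1_equality)

lemma add_perm: "xs \<in> args m H \<Longrightarrow> mset xs = mset ys \<Longrightarrow> f xs = f ys"
  using hypergroup[unfolded canonical_hypergroup_def,
      THEN conjunct2, THEN conjunct1] by blast

lemma mul_perm: "xs \<in> args n H \<Longrightarrow> mset xs = mset ys \<Longrightarrow> g xs = g ys"
  using krasner[unfolded krasner_hyperring_def,
      THEN conjunct2, THEN conjunct2, THEN conjunct1] by blast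

lemma mul_closed: "xs \<in> args n H \<Longrightarrow> g xs \<in> H"
  using krasner[unfolded krasner_hyperring_def,
      THEN conjunct2, THEN conjunct1] by blast

lemma add_closed: "xs \<in> args m H \<Longrightarrow> f xs \<subseteq> H"
  using hypergroup[unfolded canonical_hypergroup_def, THEN conjunct1] by blast

lemma add_assoc:
  assumes "as @ xs @ bs \<in> args (2 * m - 1) H" "as @ xs @ bs = cs @ ys @ ds"
    and "length xs = m" "length ys = m"
  shows "(\<Union>z\<in>f xs. f (as @ z # bs)) = (\<Union>z\<in>f ys. f (cs @ z # ds))"
  using hypergroup[unfolded canonical_hypergroup_def,
      THEN conjunct2, THEN conjunct2, THEN conjunct1] assms by blast

lemma add_reversible:
  assumes "as @ y # bs \<in> args m H" "x \<in> f (as @ y # bs)"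
  shows "y \<in> f (x # map neg (as @ bs))"
  using hypergroup[unfolded canonical_hypergroup_def,
      THEN conjunct2, THEN conjunct2, THEN conjunct2, THEN conjunct2,
      THEN conjunct2, THEN conjunct2] assms by blast

lemma distrib:
  assumes "as @ bs \<in> args (n - 1) H" "xs \<in> args m H"
  shows "(\<lambda>z. g (as @ z # bs)) ` f xs = f (map (\<lambda>x. g (as @ x # bs)) xs)"
  using krasner[unfolded krasner_hyperring_def,
      THEN conjunct2, THEN conjunct2, THEN conjunct2, THEN conjunct2, THEN conjunct1] assms by blast

text \<open>The zero axiom has the element in front; here it is permuted to the second place, so
  that the leading zero stands where classes take their element of \<open>I\<close>.\<close>

lemma add_zero: "x \<in> H \<Longrightarrow> f (z0 # x # replicate (m - 2) z0) = {x}"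
proof -
  assume x: "x \<in> H"
  have "m - 1 = Suc (m - 2)" using m_ge_2 by simp
  then have "f (x # z0 # replicate (m - 2) z0) = {x}"
    using zero x by (simp add: is_zero_def)
  moreover have "f (x # z0 # replicate (m - 2) z0) = f (z0 # x # replicate (m - 2) z0)"
    using x zero_in_carrier m_ge_2 by (intro add_perm) (auto simp: args_def)
  ultimately show ?thesis by simp
qed

lemma mul_zero:
  assumes "as @ bs \<in> args (n - 1) H"
  shows "g (as @ z0 # bs) = z0"
proof -
  have "g (as @ z0 # bs) = g (z0 # as @ bs)"
    using assms zero_in_carrier n_ge_2 by (intro mul_perm) (auto simp: args_def)
  then show ?thesis
    using krasner[unfolded krasner_hyperring_def,
      THEN conjunct2, THEN conjunct2, THEN conjunct2, THEN conjunct2, THEN conjunct2] assms by metis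
qed

lemma neg_zero: "neg z0 = z0"
  using add_zero[OF zero_in_carrier] zero_in_carrier by (intro neg_eqI) (auto simp: is_neg_def)

section \<open>Zero and negatives in hyperideals\<close>

lemma hyperideal_subset: "hyperideal m n R K \<Longrightarrow> K \<subseteq> H"
  by (simp add: hyperideal_def subhypergroup_def)

lemma hyperideal_add: "hyperideal m n R K \<Longrightarrow> xs \<in> args m K \<Longrightarrow> f xs \<subseteq> K"
  by (simp add: hyperideal_def subhypergroup_def)

lemma hyperideal_mul:
  "hyperideal m n R K \<Longrightarrow> as @ bs \<in> args (n - 1) H \<Longrightarrow> x \<in> K \<Longrightarrow> g (as @ x # bs) \<in> K"
  by (simp add: hyperideal_def)

lemma hyperideal_solve:
  "hyperideal m n R K \<Longrightarrow> as @ bs \<in> args (m - 1) K \<Longrightarrow> b \<in> K \<Longrightarrow> \<exists>x\<in>K. b \<in> f (as @ x # bs)"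
  by (simp add: hyperideal_def subhypergroup_def)

lemma zero_in_hyperideal:
  assumes K: "hyperideal m n R K"
  shows "z0 \<in> K"
proof -
  obtain a where a: "a \<in> K"
    using K by (auto simp: hyperideal_def subhypergroup_def)
  have aH: "a \<in> H" using hyperideal_subset[OF K] a by auto
  \<comment> \<open>The same list is split in two ways: absorption applies to \<open>a\<close>,
    which puts the product into \<open>K\<close>, while annihilation applies to the first zero and
    makes the product zero.\<close>
  have "g ([] @ a # z0 # replicate (n - 2) z0) \<in> K"
    using K a zero_in_carrier n_ge_2 by (intro hyperideal_mul) (auto simp: args_def)
  moreover have "g ([a] @ z0 # replicate (n - 2) z0) = z0"
    using aH zero_in_carrier n_ge_2 by (intro mul_zero) (auto simp: args_def)
  ultimately show ?thesis by simp
qed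

text \<open>Solvability inside \<open>K\<close> provides an element of \<open>K\<close> that adds to
  zero with \<open>b\<close>; since negatives are unique, it is the negative of
  \<open>b\<close>.\<close>

lemma neg_in_hyperideal:
  assumes K: "hyperideal m n R K" and b: "b \<in> K"
  shows "neg b \<in> K"
proof -
  have "\<exists>x\<in>K. z0 \<in> f ([b] @ x # replicate (m - 2) z0)"
    using zero_in_hyperideal[OF K] b m_ge_2
    by (intro hyperideal_solve[OF K]) (auto simp: args_def)
  then obtain x where x: "x \<in> K" "z0 \<in> f (b # x # replicate (m - 2) z0)" by auto
  have "neg b = x"
    using x b hyperideal_subset[OF K] by (intro neg_eqI) (auto simp: is_neg_def)
  then show ?thesis using x by simp
qed

section \<open>Classes modulo the hyperideal\<close>

lemma ideal_class_eq: "cls x = (\<Union>a\<in>I. f (a # x # replicate (m - 2) z0))"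
  using listset_singletons[of "replicate (m - 2) z0"]
  by (auto simp: ideal_class_def on_sets_def set_Cons_def)

lemma self_in_class: "x \<in> H \<Longrightarrow> x \<in> cls x"
  using zero_in_hyperideal[OF hyperideal] add_zero[of x] by (auto simp: ideal_class_eq)

lemma class_subset_hyperideal:
  assumes K: "hyperideal m n R K" and "I \<subseteq> K" "x \<in> K"
  shows "cls x \<subseteq> K"
proof -
  have "f (a # x # replicate (m - 2) z0) \<subseteq> K" if "a \<in> I" for a
    using that assms zero_in_hyperideal[OF K] m_ge_2
    by (intro hyperideal_add[OF K]) (auto simp: args_def)
  then show ?thesis by (auto simp: ideal_class_eq)
qed

text \<open>The class of \<open>x\<close> is the class of some element of \<open>K\<close>, hence a
  subset of \<open>K\<close>, and it contains \<open>x\<close>. This is how membership passes from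
  the quotient back to \<open>R\<close>.\<close>

lemma in_hyperideal_if_class_in_classes:
  assumes "hyperideal m n R K" and "I \<subseteq> K" "x \<in> H" "cls x \<in> classes m R I K"
  shows "x \<in> K"
  using assms self_in_class[of x] class_subset_hyperideal[of K]
  by (auto simp: classes_def)

text \<open>Reversibility turns \<open>v\<close> \<in> \<open>f(b, u, 0, ...)\<close> into
  \<open>u\<close> \<in> \<open>f(v, -b, 0, ...)\<close>, and \<open>-b\<close> lies in
  \<open>I\<close>.\<close>

lemma class_sym:
  assumes "u \<in> H" "v \<in> cls u"
  shows "u \<in> cls v"
proof -
  obtain b where b: "b \<in> I" "v \<in> f ([b] @ u # replicate (m - 2) z0)"
    using assms by (auto simp: ideal_class_eq)
  have bH: "b \<in> H" using b hyperideal_subset[OF hyperideal] by auto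
  have args: "[b] @ u # replicate (m - 2) z0 \<in> args m H"
    using bH assms zero_in_carrier m_ge_2 by (auto simp: args_def)
  then have vH: "v \<in> H" using add_closed b by auto
  have nb: "neg b \<in> I" by (rule neg_in_hyperideal[OF hyperideal b(1)])
  have nbH: "neg b \<in> H" using nb hyperideal_subset[OF hyperideal] by auto
  have "u \<in> f (v # map neg ([b] @ replicate (m - 2) z0))"
    using args b(2) by (rule add_reversible)
  then have "u \<in> f (v # neg b # replicate (m - 2) z0)" by (simp add: neg_zero)
  also have "f (v # neg b # replicate (m - 2) z0) = f (neg b # v # replicate (m - 2) z0)"
    using vH nbH zero_in_carrier m_ge_2 by (intro add_perm) (auto simp: args_def)
  finally show ?thesis using nb by (auto simp: ideal_class_eq)
qed

text \<open>Transitivity by associativity: \<open>f(a, f(b, u, 0, ...), 0, ...)\<close> is regrouped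
  as \<open>f(f(a, b, 0, ...), u, 0, ...)\<close>, whose inner sum stays in
  \<open>I\<close>.\<close>

lemma class_subset:
  assumes u: "u \<in> H" and v: "v \<in> cls u"
  shows "cls v \<subseteq> cls u"
proof
  let ?zs = "replicate (m - 2) z0"
  fix w assume "w \<in> cls v"
  then obtain a where a: "a \<in> I" "w \<in> f (a # v # ?zs)"
    by (auto simp: ideal_class_eq)
  obtain b where b: "b \<in> I" "v \<in> f (b # u # ?zs)"
    using v by (auto simp: ideal_class_eq)
  have H: "a \<in> H" "b \<in> H" using a b hyperideal_subset[OF hyperideal] by auto
  \<comment> \<open>With \<open>u\<close> last in the inner block, the flattened list of length
    \<open>2 * m - 1\<close> starts with \<open>a\<close>, \<open>b\<close> and \<open>m - 2\<close>
    zeros, which is exactly the block needed for the regrouping.\<close>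
  have "f (b # u # ?zs) = f (b # ?zs @ [u])"
    using H u zero_in_carrier m_ge_2 by (intro add_perm) (auto simp: args_def)
  then have "w \<in> (\<Union>v\<in>f (b # ?zs @ [u]). f ([a] @ v # ?zs))" using a b by auto
  also have "\<dots> = (\<Union>c\<in>f (a # b # ?zs). f ([] @ c # u # ?zs))"
  proof -
    have "[a] @ (b # ?zs @ [u]) @ ?zs \<in> args (2 * m - 1) H"
      using H u zero_in_carrier m_ge_2 by (auto simp: args_def)
    moreover have "[a] @ (b # ?zs @ [u]) @ ?zs = [] @ (a # b # ?zs) @ u # ?zs" by simp
    moreover have "length (b # ?zs @ [u]) = m" "length (a # b # ?zs) = m"
      using m_ge_2 by auto
    ultimately show ?thesis
      by (rule add_assoc)
  qed
  finally obtain c where c: "c \<in> f (a # b # ?zs)" "w \<in> f (c # u # ?zs)" by auto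
  have "f (a # b # ?zs) \<subseteq> I"
    using a b zero_in_hyperideal[OF hyperideal] m_ge_2
    by (intro hyperideal_add[OF hyperideal]) (auto simp: args_def)
  then show "w \<in> cls u" using c by (auto simp: ideal_class_eq)
qed

lemma class_eqI:
  assumes "u \<in> H" "v \<in> H" "v \<in> cls u"
  shows "cls v = cls u"
  using assms class_subset class_sym by blast

section \<open>Products of classes\<close>

lemma class_mul_cong_one:
  assumes abH: "as @ bs \<in> args (n - 1) H" and xy: "x \<in> H" "y \<in> H" "cls x = cls y"
  shows "cls (g (as @ x # bs)) = cls (g (as @ y # bs))"
proof -
  let ?h = "\<lambda>x. g (as @ x # bs)"
  obtain a where a: "a \<in> I" "x \<in> f (a # y # replicate (m - 2) z0)"
    using xy self_in_class[of x] by (auto simp: ideal_class_eq)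
  have "a # y # replicate (m - 2) z0 \<in> args m H"
    using a hyperideal_subset[OF hyperideal] xy zero_in_carrier m_ge_2 by (auto simp: args_def)
  then have "?h ` f (a # y # replicate (m - 2) z0) = f (map ?h (a # y # replicate (m - 2) z0))"
    by (rule distrib[OF abH])
  \<comment> \<open>Multiplication sends the padding zeros to zero, so the image of the sum is again
    of the form that defines a class, now around \<open>?h y\<close>.\<close>
  then have "?h x \<in> f (?h a # ?h y # replicate (m - 2) z0)"
    using a(2) mul_zero[OF abH] by auto
  moreover have "?h a \<in> I" by (rule hyperideal_mul[OF hyperideal abH a(1)])
  ultimately have "?h x \<in> cls (?h y)" by (auto simp: ideal_class_eq)
  moreover have "?h x \<in> H" "?h y \<in> H"
    using abH xy n_ge_2 by (auto simp: args_def intro!: mul_closed)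
  ultimately show ?thesis by (intro class_eqI)
qed

text \<open>Arguments are exchanged one at a time from the left; the prefix \<open>as\<close>
  collects those already exchanged and must be arbitrary in the induction.\<close>

lemma class_mul_cong_suffix:
  assumes "as @ xs \<in> args n H" "as @ ys \<in> args n H" "map cls xs = map cls ys"
  shows "cls (g (as @ xs)) = cls (g (as @ ys))"
  using assms
proof (induction xs arbitrary: as ys)
  case Nil
  then show ?case by simp
next
  case (Cons x xs)
  then obtain y ys' where ys: "ys = y # ys'" "cls x = cls y" "map cls xs = map cls ys'"
    by (cases ys) auto
  have "cls (g (as @ x # xs)) = cls (g (as @ y # xs))"
    using Cons.prems ys by (intro class_mul_cong_one) (auto simp: args_def)
  also have "\<dots> = cls (g ((as @ [y]) @ xs))" by simp
  also have "\<dots> = cls (g ((as @ [y]) @ ys'))"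
    using Cons.prems ys by (intro Cons.IH) (auto simp: args_def)
  finally show ?case using ys by simp
qed

text \<open>The description defining the product is proper: \<open>xs\<close> itself gives a value,
  and congruence with empty prefix shows that other representatives give the same one.\<close>

lemma mul_quotient:
  assumes "xs \<in> args n H"
  shows "mulop Q (map cls xs) = cls (g xs)"
proof -
  have "mulop Q (map cls xs) =
      (THE Y. \<exists>ys\<in>args n H. map cls xs = map cls ys \<and> Y = cls (g ys))"
    by (simp add: quotient_hyperring_def)
  also have "\<dots> = cls (g xs)"
  proof (rule the_equality)
    show "\<exists>ys\<in>args n H. map cls xs = map cls ys \<and> cls (g xs) = cls (g ys)"
      using assms by blast
    show "Y = cls (g xs)" if ex: "\<exists>ys\<in>args n H. map cls xs = map cls ys \<and> Y = cls (g ys)" for Y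
    proof -
      obtain ys where ys: "ys \<in> args n H" "map cls xs = map cls ys" "Y = cls (g ys)"
        using ex by blast
      then have "cls (g ([] @ xs)) = cls (g ([] @ ys))"
        using assms by (intro class_mul_cong_suffix) simp_all
      then show ?thesis using ys(3) by simp
    qed
  qed
  finally show ?thesis .
qed

section \<open>Descent to the quotient\<close>

lemma carrier_quotient: "carrier Q = classes m R I H"
  by (simp add: quotient_hyperring_def)

lemma add_quotient: "addop Q Xs = classes m R I (on_sets f Xs)"
  by (simp add: quotient_hyperring_def classes_def)

lemma class_in_classes: "x \<in> A \<Longrightarrow> cls x \<in> classes m R I A"
  by (auto simp: classes_def)

lemma classes_mono: "A \<subseteq> B \<Longrightarrow> classes m R I A \<subseteq> classes m R I B"
  by (auto simp: classes_def)

lemma multiplicative_subset_quotient: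
  assumes "multiplicative_subset n R S"
  shows "multiplicative_subset n Q (classes m R I S)"
  unfolding multiplicative_subset_def
proof (intro conjI ballI)
  have S: "S \<subseteq> H" "S \<noteq> {}" using assms by (auto simp: multiplicative_subset_def)
  show "classes m R I S \<subseteq> carrier Q" using S by (simp add: carrier_quotient classes_mono)
  show "classes m R I S \<noteq> {}" using S by (auto simp: classes_def)
  fix Xs assume "Xs \<in> args n (classes m R I S)"
  then obtain xs where xs: "xs \<in> args n S" "Xs = map cls xs" by (rule args_classesE)
  then have "xs \<in> args n H" using S by (auto simp: args_def)
  moreover have "g xs \<in> S" using xs assms by (simp add: multiplicative_subset_def)
  ultimately show "mulop Q Xs \<in> classes m R I S"
    using xs by (simp add: mul_quotient class_in_classes)
qed

text \<open>Sums are handled through inclusion of classes in \<open>J\<close>; for solvability and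
  absorption, the corresponding property of \<open>J\<close> is applied to representatives.\<close>

lemma hyperideal_quotient:
  assumes J: "hyperideal m n R J" and IJ: "I \<subseteq> J"
  shows "hyperideal m n Q (classes m R I J)"
  unfolding hyperideal_def subhypergroup_def
proof (intro conjI ballI allI impI)
  have JH: "J \<subseteq> H" by (rule hyperideal_subset[OF J])
  show "classes m R I J \<subseteq> carrier Q" using JH by (simp add: carrier_quotient classes_mono)
  show "classes m R I J \<noteq> {}" using zero_in_hyperideal[OF J] by (auto simp: classes_def)
  show "addop Q Xs \<subseteq> classes m R I J" if "Xs \<in> args m (classes m R I J)" for Xs
  proof -
    have "X \<subseteq> J" if "X \<in> set Xs" for X
      using that \<open>Xs \<in> _\<close> class_subset_hyperideal[OF J IJ]
      by (fastforce simp: args_def classes_def)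
    \<comment> \<open>Each entry of \<open>Xs\<close> is a subset of \<open>J\<close>, so every
      choice of elements from the entries is an argument list over \<open>J\<close>.\<close>
    then have "listset Xs \<subseteq> args m J"
      using \<open>Xs \<in> _\<close>
      by (fastforce simp: in_listset_iff args_def list_all2_conv_all_nth in_set_conv_nth)
    then have "on_sets f Xs \<subseteq> J"
      using hyperideal_add[OF J] by (auto simp: on_sets_def)
    then show ?thesis by (simp add: add_quotient classes_mono)
  qed
  show "\<exists>X\<in>classes m R I J. B \<in> addop Q (As @ X # Bs)"
    if AB: "As @ Bs \<in> args (m - 1) (classes m R I J)" and B: "B \<in> classes m R I J" for As Bs B
  proof -
    obtain xs where xs: "xs \<in> args (m - 1) J" "As @ Bs = map cls xs"
      using AB by (rule args_classesE)
    then obtain as bs where ab: "xs = as @ bs" "As = map cls as" "Bs = map cls bs"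
      by (metis append_eq_map_conv)
    obtain b where b: "b \<in> J" "B = cls b" using B by (auto simp: classes_def)
    obtain x where x: "x \<in> J" "b \<in> f (as @ x # bs)"
      using hyperideal_solve[OF J _ b(1)] xs(1) ab(1) by blast
    have "set (as @ x # bs) \<subseteq> H"
      using xs(1) ab(1) x(1) JH by (auto simp: args_def)
    \<comment> \<open>Each representative lies in its own class, so the list that solves the
      equation in \<open>R\<close> is one of the choices over which the sum of the classes is
      taken.\<close>
    then have "as @ x # bs \<in> listset (map cls (as @ x # bs))"
      unfolding in_listset_iff list_all2_map2
      by (intro list.rel_refl_strong self_in_class) blast
    then have "b \<in> on_sets f (As @ cls x # Bs)" using x(2) ab by (auto simp: on_sets_def)
    then show ?thesis using x b by (auto simp: add_quotient intro: class_in_classes)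
  qed
  show "mulop Q (As @ X # Bs) \<in> classes m R I J"
    if AB: "As @ Bs \<in> args (n - 1) (carrier Q)" and X: "X \<in> classes m R I J" for As Bs X
  proof -
    obtain xs where xs: "xs \<in> args (n - 1) H" "As @ Bs = map cls xs"
      using AB unfolding carrier_quotient by (rule args_classesE)
    then obtain as bs where ab: "xs = as @ bs" "As = map cls as" "Bs = map cls bs"
      by (metis append_eq_map_conv)
    obtain x where x: "x \<in> J" "X = cls x" using X by (auto simp: classes_def)
    have "as @ x # bs \<in> args n H"
      using xs(1) ab(1) x(1) JH n_ge_2 by (auto simp: args_def)
    then have "mulop Q (As @ X # Bs) = cls (g (as @ x # bs))"
      using mul_quotient[of "as @ x # bs"] ab x by simp
    moreover have "g (as @ x # bs) \<in> J"
      using hyperideal_mul[OF J _ x(1)] xs(1) ab(1) by blast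
    ultimately show ?thesis by (simp add: class_in_classes)
  qed
qed

lemma S_prime_quotient:
  assumes e: "e \<in> H" and prime: "S_prime_hyperideal m n R e S J" and IJ: "I \<subseteq> J"
  shows "S_prime_hyperideal m n Q (cls e) (classes m R I S) (classes m R I J)"
proof -
  have S: "multiplicative_subset n R S" and J: "hyperideal m n R J" and disj: "J \<inter> S = {}"
    using prime by (auto simp: S_prime_hyperideal_def)
  have SH: "S \<subseteq> H" using S by (simp add: multiplicative_subset_def)
  obtain s where s: "s \<in> S"
    and s_prime: "\<And>xs. xs \<in> args n H \<Longrightarrow> g xs \<in> J \<Longrightarrow>
      \<exists>i<n. g (s # xs ! i # replicate (n - 2) e) \<in> J"
    using prime by (auto simp: S_prime_hyperideal_def)
  have "classes m R I J \<inter> classes m R I S = {}"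
  proof (rule equals0I)
    fix X assume X: "X \<in> classes m R I J \<inter> classes m R I S"
    then obtain t where t: "t \<in> S" "X = cls t" by (auto simp: classes_def)
    \<comment> \<open>A class common to both quotients has a representative in \<open>S\<close>,
      which saturation of \<open>J\<close> forces into \<open>J\<close> as well.\<close>
    then have "t \<in> J" using in_hyperideal_if_class_in_classes[OF J IJ] SH X by blast
    then show False using t disj by blast
  qed
  moreover have "\<exists>i<n. mulop Q (cls s # Xs ! i # replicate (n - 2) (cls e)) \<in> classes m R I J"
    if Xs: "Xs \<in> args n (carrier Q)" and prod: "mulop Q Xs \<in> classes m R I J" for Xs
  proof -
    obtain xs where xs: "xs \<in> args n H" "Xs = map cls xs"
      using Xs unfolding carrier_quotient by (rule args_classesE)
    \<comment> \<open>The product of the classes is the class of \<open>g xs\<close>, and saturation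
      lifts its membership to \<open>R\<close>, where primeness of \<open>J\<close> selects the
      index.\<close>
    have "g xs \<in> J"
      using in_hyperideal_if_class_in_classes[OF J IJ] prod xs
      by (simp add: mul_quotient mul_closed)
    then obtain i where i: "i < n" "g (s # xs ! i # replicate (n - 2) e) \<in> J"
      using s_prime xs by blast
    have len: "i < length xs" using i xs by (simp add: args_def)
    then have "xs ! i \<in> H" using xs nth_mem[OF len] by (auto simp: args_def)
    then have "s # xs ! i # replicate (n - 2) e \<in> args n H"
      using s SH e n_ge_2 by (auto simp: args_def)
    \<comment> \<open>Applying \<open>cls\<close> entrywise to this list gives the required argument
      list; the bound \<open>len\<close> identifies the class of \<open>xs ! i\<close> with
      \<open>Xs ! i\<close>.\<close>
    from mul_quotient[OF this] show ?thesis
      using i xs len by (auto simp: class_in_classes)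
  qed
  ultimately show ?thesis
    unfolding S_prime_hyperideal_def
    using multiplicative_subset_quotient[OF S] hyperideal_quotient[OF J IJ] s class_in_classes
    by blast
qed

end

theorem theorem3p15:
  fixes m n :: nat and R :: "'a hyperring" and e :: 'a and S I J :: "'a set"
  assumes "m \<ge> 2" and "n \<ge> 2"
    and "krasner_hyperring m n R"
    and "scalar_identity n R e"
    and "multiplicative_subset n R S"
    and "normal_hyperideal m n R I"
    and "S_prime_hyperideal m n R e S J"
    and "I \<subseteq> J"
  shows "S_prime_hyperideal m n (quotient_hyperring m n R I) (ideal_class m R I e)
           (classes m R I S) (classes m R I J)"
proof -
  interpret krasner_hyperideal m n R I
    using assms by unfold_locales (auto simp: normal_hyperideal_def)
  show ?thesis
    using assms by (intro S_prime_quotient) (auto simp: scalar_identity_def)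
qed

end
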